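(* Let the integers $t_o(n)$, $n\ge 0$, be defined by the formal power series identity \[ \sum_{n\ge 0}t_o(n)q^n=\sum_{n\ge 0}\frac{(-q;q)_{2n}}{(q;q^2)_{n+1}}\,q^{2n}. \] Then for every integer $n\ge 0$: if $8n+9$ is not represented by the binary quadratic form $x^2+2y^2$ (that is, there are no integers $x,y$ with $8n+9=x^2+2y^2$), then \[ t_o(n)\equiv 0\pmod{2}. \]
   Context: For $n\in\mathbb{N}_0$, the $q$-Pochhammer symbol is $(a;q)_n:=\prod_{j=0}^{n-1}(1-aq^j)$, with the empty product equal to $1$. Thus $(-q;q)_{2n}=\prod_{j=1}^{2n}(1+q^j)$ and $(q;q^2)_{n+1}=\prod_{j=0}^{n}(1-q^{2j+1})$. The series is an identity in the ring of formal power series $\mathbb{Z}[[q]]$, where each $1/(q;q^2)_{n+1}$ is expanded as a power series in $q$; the sum over $n$ converges $q$-adically because of the factor $q^{2n}$. *)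

theory Defs
  imports
    "HOL-Computational_Algebra.Formal_Power_Series"
    "HOL-Number_Theory.Cong"
begin

definition qpochhammer :: "'a::comm_ring_1 \<Rightarrow> 'a \<Rightarrow> nat \<Rightarrow> 'a" where
  "qpochhammer a q n = (\<Prod>j<n. 1 - a * q ^ j)"

text \<open>
  The type \<^typ>\<open>int\<close> is not an instance of the class \<^class>\<open>inverse\<close>, so
  \<^const>\<open>inverse\<close> and division are unavailable on \<^typ>\<open>int fps\<close>.  The reciprocal of a series
  with constant coefficient 1 is \<^term>\<open>fps_right_inverse f 1\<close>, where the argument 1 is the
  inverse of the constant coefficient; see \<open>qpochhammer_odd_inverse\<close> below.
\<close>

definition t_o_summand :: "nat \<Rightarrow> int fps" where
  "t_o_summand n =
     qpochhammer (- fps_X) fps_X (2 * n)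
       * fps_right_inverse (qpochhammer fps_X (fps_X\<^sup>2) (n + 1)) 1
       * fps_X ^ (2 * n)"

text \<open>The infinite sum is taken in the standard (\<open>X\<close>-adic) metric on \<^typ>\<open>int fps\<close>.\<close>

definition t_o :: "nat \<Rightarrow> int" where
  "t_o k = fps_nth (\<Sum>n. t_o_summand n) k"

lemma qpochhammer_odd_inverse:
  "qpochhammer fps_X (fps_X\<^sup>2) n * fps_right_inverse (qpochhammer fps_X (fps_X\<^sup>2) n) 1
     = (1 :: int fps)"
proof (rule fps_right_inverse)
  show "fps_nth (qpochhammer fps_X (fps_X\<^sup>2) n) 0 * 1 = (1 :: int)"
    unfolding qpochhammer_def by (induction n) simp_all
qed

lemma t_o_summand_nth_eq_0:
  assumes "k < 2 * n"
  shows "fps_nth (t_o_summand n) k = 0"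
  using assms by (simp add: t_o_summand_def fps_X_power_mult_right_nth)

theorem t_o_summand_sums: "t_o_summand sums Abs_fps t_o"
proof -
  define F where "F = Abs_fps (\<lambda>k. \<Sum>n\<le>k. fps_nth (t_o_summand n) k)"
  have "t_o_summand sums F"
    unfolding sums_def
  proof (rule tendsto_fpsI)
    fix k
    have "fps_nth (\<Sum>n<N. t_o_summand n) k = fps_nth F k" if "N \<ge> Suc k" for N
    proof -
      have "fps_nth (\<Sum>n<N. t_o_summand n) k = (\<Sum>n<N. fps_nth (t_o_summand n) k)"
        by (simp add: fps_sum_nth)
      also have "\<dots> = (\<Sum>n\<le>k. fps_nth (t_o_summand n) k)"
        using that by (intro sum.mono_neutral_right) (auto intro!: t_o_summand_nth_eq_0)
      finally show ?thesis
        by (simp add: F_def)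
    qed
    then show "\<forall>\<^sub>F N in sequentially. fps_nth (\<Sum>n<N. t_o_summand n) k = fps_nth F k"
      by (rule eventually_sequentiallyI)
  qed
  moreover from this have "Abs_fps t_o = F"
    by (simp add: t_o_def fps_eq_iff sums_iff)
  ultimately show ?thesis
    by simp
qed

end

theory Submission
  imports Defs
begin

text \<open>
  Modulo 2 the signs in \<open>(-q;q)\<^bsub>2n\<^esub>\<close> are irrelevant, so the factors of \<open>(-q;q\<^sup>2)\<^sub>n\<close> cancel against
  those of \<open>(q;q\<^sup>2)\<^bsub>n+1\<^esub>\<close> and the generating function is congruent to
  \<open>\<Sum>\<^sub>n (-1)\<^sup>n (-q\<^sup>2;q\<^sup>2)\<^sub>n q\<^bsup>2n\<^esup> / (1 - q\<^bsup>2n+1\<^esup>)\<close>.  With these signs the series equals the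
  Hecke-type double sum \<open>\<Sum>\<^sub>k \<Sum>\<^bsub>j < 2k+2\<^esub> q\<^bsup>k(k+2) + j(j+1)/2\<^esup>\<close> over the integers, by Bailey's
  lemma with \<open>a = q\<^sup>4\<close>, base \<open>q\<^sup>2\<close> and parameters \<open>q\<^sup>2, - q\<^sup>2\<close>.  If \<open>e\<close> is one of its exponents, then
  \<open>8e + 9 = (2j+1)\<^sup>2 + 2(2k+2)\<^sup>2\<close>.
\<close>

section \<open>Reciprocals of the q-Pochhammer symbols (q^2;q^2)_n\<close>

text \<open>\<open>r n\<close> plays the part of 1/(q^2;q^2)_n. Taking it as a parameter keeps the
  identities of this locale finite and free of division, in any commutative ring.\<close>

locale q_reciprocals =
  fixes q :: "'a::comm_ring_1" and r :: "nat \<Rightarrow> 'a"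
  assumes pochhammer_r: "qpochhammer (q\<^sup>2) (q\<^sup>2) n * r n = 1"
begin

lemma pochhammer_Suc:
  "qpochhammer (q\<^sup>2) (q\<^sup>2) (Suc n) = qpochhammer (q\<^sup>2) (q\<^sup>2) n * (1 - q ^ (2 * n + 2))"
proof -
  have "q\<^sup>2 * (q\<^sup>2) ^ n = q ^ (2 * n + 2)"
    unfolding power_mult [symmetric] power_add [symmetric] by simp
  then show ?thesis
    by (simp add: qpochhammer_def)
qed

lemma r_0: "r 0 = 1"
  using pochhammer_r [of 0] by (simp add: qpochhammer_def)

lemma r_Suc: "r n = (1 - q ^ (2 * n + 2)) * r (Suc n)"
proof -
  have "r n = r n * (qpochhammer (q\<^sup>2) (q\<^sup>2) (Suc n) * r (Suc n))"
    by (simp only: pochhammer_r mult_1_right)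
  also have "\<dots> = (qpochhammer (q\<^sup>2) (q\<^sup>2) n * r n) * ((1 - q ^ (2 * n + 2)) * r (Suc n))"
    unfolding pochhammer_Suc by (simp only: mult_ac)
  finally show ?thesis
    by (simp only: pochhammer_r mult_1)
qed

text \<open>The convention 1/(q^2;q^2)_m = 0 for m < 0, which truncated subtraction alone would
  lose. It lets sums over k run past n.\<close>

definition rd :: "nat \<Rightarrow> nat \<Rightarrow> 'a" where
  "rd n k = (if k \<le> n then r (n - k) else 0)"

lemma rd_eq_0 [simp]: "n < k \<Longrightarrow> rd n k = 0"
  by (simp add: rd_def)

text \<open>The factor is a unit because it divides (q^2;q^2)_{n+1}, so it cancels even in the
  presence of zero divisors.\<close>

lemma cancel_factor:
  assumes "(1 - q ^ (2 * n + 2)) * x = (1 - q ^ (2 * n + 2)) * y"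
  shows "x = y"
proof -
  define u where "u = qpochhammer (q\<^sup>2) (q\<^sup>2) n * r (Suc n)"
  have "u * (1 - q ^ (2 * n + 2)) = 1"
    using pochhammer_r [of "Suc n"] unfolding u_def pochhammer_Suc by (simp only: mult_ac)
  then have "x = u * ((1 - q ^ (2 * n + 2)) * x)" "y = u * ((1 - q ^ (2 * n + 2)) * y)"
    by (simp_all only: mult.assoc [symmetric] mult_1)
  then show ?thesis
    by (simp only: assms)
qed

lemma rd_Suc_right:
  assumes "k \<le> n"
  shows "rd n (Suc k) = (1 - q ^ (2 * (n - k))) * rd n k"
proof (cases "k = n")
  case False
  with assms obtain m where "n = Suc k + m"
    using le_Suc_ex [of "Suc k" n] by auto
  then show ?thesis
    using r_Suc [of m] by (simp add: rd_def Suc_diff_le)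
qed simp

section \<open>A finite pentagonal number theorem\<close>

text \<open>A Zeilberger-type certificate: \<open>H\<close> makes the recurrence in n for the sum in
  \<open>finite_pentagonal\<close> telescope in k.\<close>

lemma pentagonal_step:
  assumes "k \<le> Suc n"
  defines "H \<equiv> \<lambda>k. (- 1) ^ k * q ^ (3 * k\<^sup>2 + k + 2 * (Suc n - k)) * (1 - q ^ (2 * k))
                     * rd (Suc n) k * r (Suc n + k)"
  shows "(1 - q ^ (2 * n + 2)) *
           ((- 1) ^ k * q ^ (3 * k\<^sup>2 + k) * (1 - q ^ (4 * k + 2)) * rd (Suc n) k * r (Suc n + k + 1))
         - (- 1) ^ k * q ^ (3 * k\<^sup>2 + k) * (1 - q ^ (4 * k + 2)) * rd n k * r (n + k + 1)
         = H k - H (Suc k)"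
proof (cases "k \<le> n")
  case True
  then obtain m where n: "n = k + m"
    using le_Suc_ex by blast
  \<comment> \<open>With u, v for powers of q and a, b for the reciprocals of largest index, the
    claim becomes a polynomial identity. The later certificates are checked in the same way.\<close>
  define a b where "a = r (Suc m)" and "b = r (2 * k + m + 2)"
  define c u v where "c = (- 1) ^ k * q ^ (3 * k\<^sup>2 + k)" and "u = q ^ k" and "v = q ^ m"
  have pow: "q ^ (2 * m + 2) = v\<^sup>2 * q\<^sup>2" "q ^ (2 * (2 * k + m + 1) + 2) = u ^ 4 * v\<^sup>2 * q ^ 4"
    "q ^ (2 * (k + m) + 2) = u\<^sup>2 * v\<^sup>2 * q\<^sup>2" "q ^ (4 * k + 2) = u ^ 4 * q\<^sup>2"
    "q ^ (2 * k) = u\<^sup>2" "q ^ (2 * Suc k) = u\<^sup>2 * q\<^sup>2"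
    unfolding u_def v_def power_mult [symmetric] power_add [symmetric]
    by (rule arg_cong [where f = "power q"]; simp)+
  have pow_c: "(- 1) ^ k * q ^ (3 * k\<^sup>2 + k + 2 * Suc m) = c * (v\<^sup>2 * q\<^sup>2)"
    "(- 1) ^ Suc k * q ^ (3 * (Suc k)\<^sup>2 + Suc k + 2 * m) = - c * (u ^ 6 * v\<^sup>2 * q ^ 4)"
    unfolding u_def v_def c_def power_mult [symmetric] power_add [symmetric] mult.assoc power_Suc
        mult_minus_left mult_1
    by (simp_all add: algebra_simps power2_eq_square flip: power_add)
  have rm: "r m = (1 - v\<^sup>2 * q\<^sup>2) * a"
    using r_Suc [of m] unfolding pow a_def by simp
  have rd: "rd (Suc n) k = a" "rd n k = (1 - v\<^sup>2 * q\<^sup>2) * a"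
    "rd (Suc n) (Suc k) = (1 - v\<^sup>2 * q\<^sup>2) * a"
    unfolding n using rm by (simp_all add: a_def rd_def Suc_diff_le)
  have rb: "r (2 * k + m + 1) = (1 - u ^ 4 * v\<^sup>2 * q ^ 4) * b"
    using r_Suc [of "2 * k + m + 1"] unfolding pow b_def by simp
  have idx: "Suc n + k + 1 = 2 * k + m + 2" "Suc n + k = 2 * k + m + 1" "n + k + 1 = 2 * k + m + 1"
    "Suc n + Suc k = 2 * k + m + 2" "2 * k + m + 1 + 1 = 2 * k + m + 2" "Suc n - k = Suc m" "Suc n - Suc k = m"
    using n by simp_all
  have H: "H k = c * (v\<^sup>2 * q\<^sup>2) * (1 - u\<^sup>2) * a * ((1 - u ^ 4 * v\<^sup>2 * q ^ 4) * b)"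
    "H (Suc k) = - c * (u ^ 6 * v\<^sup>2 * q ^ 4) * (1 - u\<^sup>2 * q\<^sup>2) * ((1 - v\<^sup>2 * q\<^sup>2) * a) * b"
    unfolding H_def rd idx pow_c pow rb b_def by (rule refl)+
  show ?thesis
    unfolding H rd idx rb b_def [symmetric] c_def [symmetric] unfolding n pow
    by (simp add: algebra_simps eval_nat_numeral)
next
  case False
  with assms have k: "k = Suc n" by simp
  have e: "2 * (Suc n + k) + 2 = 4 * k + 2"
    using k by simp
  have r: "r (Suc n + k) = (1 - q ^ (4 * k + 2)) * r (Suc (Suc n + k))"
    using r_Suc [of "Suc n + k"] unfolding e .
  have idx: "Suc n - k = 0" "2 * n + 2 = 2 * k" "Suc n + k + 1 = Suc (Suc n + k)"
    using k by simp_all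
  have rd: "rd (Suc n) k = 1" "rd n k = 0" "rd (Suc n) (Suc k) = 0"
    by (simp_all add: k rd_def r_0)
  show ?thesis
    unfolding H_def rd idx r by simp
qed

text \<open>Formally, n to infinity gives Euler's pentagonal number theorem in base q^2. Both sides
  satisfy (1 - q^(2n+2)) x_{n+1} = x_n and agree at n = 0.\<close>

lemma finite_pentagonal:
  "(\<Sum>k\<le>n. (- 1) ^ k * q ^ (3 * k\<^sup>2 + k) * (1 - q ^ (4 * k + 2)) * rd n k * r (n + k + 1)) = r n"
proof (induction n)
  case 0
  have "(1 - q\<^sup>2) * r (Suc 0) = r 0"
    using r_Suc [of 0] by (simp only: mult_0_right add_0_left)
  then show ?case
    by (simp add: r_0 rd_def power2_eq_square)
next
  case (Suc n)
  let ?e = "\<lambda>n k. (- 1) ^ k * q ^ (3 * k\<^sup>2 + k) * (1 - q ^ (4 * k + 2)) * rd n k * r (n + k + 1)"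
  let ?H = "\<lambda>k. (- 1) ^ k * q ^ (3 * k\<^sup>2 + k + 2 * (Suc n - k)) * (1 - q ^ (2 * k))
                     * rd (Suc n) k * r (Suc n + k)"
  have "(1 - q ^ (2 * n + 2)) * (\<Sum>k\<le>Suc n. ?e (Suc n) k) - (\<Sum>k\<le>Suc n. ?e n k)
      = (\<Sum>k\<le>Suc n. ?H k - ?H (Suc k))"
    unfolding sum_distrib_left sum_subtractf [symmetric]
    by (intro sum.cong refl pentagonal_step) auto
  also have "\<dots> = ?H 0 - ?H (Suc (Suc n))"
    by (rule sum_telescope)
  \<comment> \<open>\<open>?H 0\<close> contains 1 - q^0, and the other term contains
    \<open>rd (Suc n) (Suc (Suc n))\<close>, which is 0.\<close>
  also have "\<dots> = 0"
    by simp
  finally have "(1 - q ^ (2 * n + 2)) * (\<Sum>k\<le>Suc n. ?e (Suc n) k) - (\<Sum>k\<le>Suc n. ?e n k) = 0" .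
  then have "(1 - q ^ (2 * n + 2)) * (\<Sum>k\<le>Suc n. ?e (Suc n) k) = (\<Sum>k\<le>Suc n. ?e n k)"
    by (rule eq_iff_diff_eq_0 [THEN iffD2])
  also have "\<dots> = r n"
    unfolding sum.atMost_Suc Suc.IH by simp
  also have "\<dots> = (1 - q ^ (2 * n + 2)) * r (Suc n)"
    by (rule r_Suc)
  finally show ?case
    by (rule cancel_factor)
qed

section \<open>Partial theta sums and a Bailey pair\<close>

definition tri_sum :: "nat \<Rightarrow> 'a" where
  "tri_sum m = (\<Sum>j<m. q ^ (j * (j + 1) div 2))"

lemma tri_sum_step:
  "tri_sum (2 * Suc k) - tri_sum (2 * k) = q ^ (2 * k\<^sup>2 + k) * (1 + q ^ (2 * k + 1))"
proof -
  have "2 * k * (2 * k + 1) div 2 = 2 * k\<^sup>2 + k"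
      "Suc (2 * k) * (Suc (2 * k) + 1) div 2 = 2 * k\<^sup>2 + k + (2 * k + 1)"
    by (simp_all add: power2_eq_square algebra_simps)
  then have "tri_sum (Suc (Suc (2 * k))) - tri_sum (2 * k)
      = q ^ (2 * k\<^sup>2 + k) + q ^ (2 * k\<^sup>2 + k + (2 * k + 1))"
    unfolding tri_sum_def by (simp only: sum.lessThan_Suc) simp
  then show ?thesis
    by (simp only: power_add [of _ "2 * k\<^sup>2 + k" "2 * k + 1"] distrib_left mult_1_right mult_Suc_right
        add_2_eq_Suc)
qed

lemma bailey_step:
  assumes "k \<le> n"
  defines "G \<equiv> \<lambda>k. (- 1) ^ k * (q ^ k\<^sup>2 - q ^ (Suc k)\<^sup>2) * rd n k * r (n + k + 1)"
  shows "(1 - q ^ (2 * n + 1)) * ((- 1) ^ k * q ^ k\<^sup>2 * (1 - q ^ (4 * k + 4)) * rd n k * r (n + k + 2))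
         = G k - G (Suc k)"
proof -
  obtain m where n: "n = k + m"
    using assms le_Suc_ex by blast
  define a b where "a = rd n k" and "b = r (n + k + 2)"
  define c u v where "c = (- 1) ^ k * q ^ k\<^sup>2" and "u = q ^ k" and "v = q ^ m"
  have pow: "q ^ (2 * m) = v\<^sup>2" "q ^ (2 * (n + k + 1) + 2) = u ^ 4 * v\<^sup>2 * q ^ 4"
    "q ^ (2 * n + 1) = u\<^sup>2 * v\<^sup>2 * q" "q ^ (4 * k + 4) = u ^ 4 * q ^ 4"
    unfolding u_def v_def n power_mult [symmetric] power_add [symmetric] power_Suc2 [symmetric]
    by (rule arg_cong [where f = "power q"]; simp)+
  have sq: "q ^ (Suc k)\<^sup>2 = q ^ k\<^sup>2 * (u\<^sup>2 * q)" "q ^ (Suc (Suc k))\<^sup>2 = q ^ k\<^sup>2 * (u ^ 4 * q ^ 4)"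
    unfolding u_def power_mult [symmetric] power_add [symmetric] power_Suc2 [symmetric]
    by (rule arg_cong [where f = "power q"]; simp add: power2_eq_square)+
  have rd: "rd n (Suc k) = (1 - v\<^sup>2) * a"
    using rd_Suc_right [OF assms(1)] unfolding a_def n diff_add_inverse pow .
  have r: "r (n + k + 1) = (1 - u ^ 4 * v\<^sup>2 * q ^ 4) * b"
    using r_Suc [of "n + k + 1"] unfolding pow b_def by simp
  have idx: "n + Suc k + 1 = n + k + 2"
    by simp
  have G: "G k = c * (1 - u\<^sup>2 * q) * a * ((1 - u ^ 4 * v\<^sup>2 * q ^ 4) * b)"
    "G (Suc k) = - c * (u\<^sup>2 * q - u ^ 4 * q ^ 4) * ((1 - v\<^sup>2) * a) * b"
    unfolding G_def sq idx c_def rd r a_def [symmetric] b_def [symmetric]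
    by (simp_all add: right_diff_distrib mult.assoc)
  show ?thesis
    unfolding G c_def [symmetric] a_def [symmetric] b_def [symmetric] pow
    by (simp add: algebra_simps eval_nat_numeral)
qed

text \<open>
  In other words, \<open>1 / ((q\<^sup>2;q\<^sup>2)\<^sub>n (1 - q\<^bsup>2n+1\<^esup>))\<close> is the \<open>\<beta>\<close>-side of a Bailey pair relative to
  \<open>a = q\<^sup>4\<close> in base \<open>q\<^sup>2\<close>.  Without the factor \<^term>\<open>tri_sum\<close> the sum is Gosper-summable
  (\<open>bailey_step\<close>), so summation by parts replaces \<^term>\<open>tri_sum\<close> by its increments.
\<close>
lemma bailey_pair:
  "(1 - q ^ (2 * n + 1)) *
     (\<Sum>k\<le>n. (- 1) ^ k * q ^ k\<^sup>2 * (1 - q ^ (4 * k + 4))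
         * rd n k * r (n + k + 2) * tri_sum (2 * Suc k))
   = r n"
proof -
  define G where "G = (\<lambda>k. (- 1) ^ k * (q ^ k\<^sup>2 - q ^ (Suc k)\<^sup>2) * rd n k * r (n + k + 1))"
  \<comment> \<open>Abel summation, without a lower boundary term because \<open>tri_sum 0\<close>
    is 0.\<close>
  have by_parts: "(\<Sum>k\<le>m. (G k - G (Suc k)) * tri_sum (2 * Suc k))
      = (\<Sum>k\<le>m. G k * (tri_sum (2 * Suc k) - tri_sum (2 * k))) - G (Suc m) * tri_sum (2 * Suc m)" for m
  proof (induction m)
    case 0
    show ?case
      by (simp add: tri_sum_def left_diff_distrib)
  next
    case (Suc m)
    then show ?case
      unfolding sum.atMost_Suc Suc.IH
      by (simp add: left_diff_distrib right_diff_distrib del: mult_Suc_right)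
  qed
  have "(1 - q ^ (2 * n + 1)) *
     (\<Sum>k\<le>n. (- 1) ^ k * q ^ k\<^sup>2 * (1 - q ^ (4 * k + 4))
         * rd n k * r (n + k + 2) * tri_sum (2 * Suc k))
     = (\<Sum>k\<le>n. (G k - G (Suc k)) * tri_sum (2 * Suc k))"
    unfolding sum_distrib_left
  proof (rule sum.cong [OF refl])
    fix k assume "k \<in> {..n}"
    then have "k \<le> n" by simp
    from bailey_step [OF this] show "(1 - q ^ (2 * n + 1)) * ((- 1) ^ k * q ^ k\<^sup>2 * (1 - q ^ (4 * k + 4))
        * rd n k
        * r (n + k + 2) * tri_sum (2 * Suc k)) = (G k - G (Suc k)) * tri_sum (2 * Suc k)"
      unfolding G_def by (simp only: mult.assoc [symmetric])
  qed
  \<comment> \<open>The upper boundary term vanishes with \<open>rd n (Suc n)\<close>.\<close>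
  also have "\<dots> = (\<Sum>k\<le>n. G k * (tri_sum (2 * Suc k) - tri_sum (2 * k)))"
    unfolding by_parts by (simp add: G_def)
  \<comment> \<open>The factor 1 + q^(2k+1) of the increment meets 1 - q^(2k+1) in
    \<open>G k\<close>; the result is exactly the pentagonal sum.\<close>
  also have "\<dots> = (\<Sum>k\<le>n. (- 1) ^ k * q ^ (3 * k\<^sup>2 + k) * (1 - q ^ (4 * k + 2))
      * rd n k * r (n + k + 1))"
  proof (rule sum.cong [OF refl])
    fix k
    have pow: "q ^ (Suc k)\<^sup>2 = q ^ k\<^sup>2 * q ^ (2 * k + 1)"
        "q ^ (3 * k\<^sup>2 + k) = q ^ k\<^sup>2 * q ^ (2 * k\<^sup>2 + k)"
      "q ^ (4 * k + 2) = q ^ (2 * k + 1) * q ^ (2 * k + 1)"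
      unfolding power_add [symmetric] by (rule arg_cong [where f = "power q"]; simp add: power2_eq_square)+
    have "s * (x - x * g) * d * e * (p * (1 + g)) = s * (x * p) * (1 - g * g) * d * e"
      for s x g d e p :: 'a
      by (simp add: algebra_simps)
    then show "G k * (tri_sum (2 * Suc k) - tri_sum (2 * k))
        = (- 1) ^ k * q ^ (3 * k\<^sup>2 + k) * (1 - q ^ (4 * k + 2)) * rd n k * r (n + k + 1)"
      unfolding tri_sum_step G_def pow
      .
  qed
  also have "\<dots> = r n"
    by (rule finite_pentagonal)
  finally show ?thesis .
qed

section \<open>A truncated q-Gauss sum\<close>

text \<open>The n-dependent part of the k-th term after \<open>bailey_pair\<close> is inserted into
  the series; (q^4;q^4)_n arises as (-q^2;q^2)_n (q^2;q^2)_n.\<close>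

definition gauss_term :: "nat \<Rightarrow> nat \<Rightarrow> 'a" where
  "gauss_term k n = (- 1) ^ n * qpochhammer (q ^ 4) (q ^ 4) n * q ^ (2 * n) * (1 - q ^ (4 * k + 4))
      * rd n k * r (n + k + 2)"

lemma pochhammer4_Suc:
  "qpochhammer (q ^ 4) (q ^ 4) (Suc n) = qpochhammer (q ^ 4) (q ^ 4) n * (1 - q ^ (4 * n + 4))"
proof -
  have "q ^ 4 * (q ^ 4) ^ n = q ^ (4 * n + 4)"
    unfolding power_mult [symmetric] power_add [symmetric] by (simp add: add.commute)
  then show ?thesis
    by (simp add: qpochhammer_def)
qed

text \<open>Start of the recursion in k: the partial sums have a closed form whose remainder carries
  q^(2M).\<close>

lemma gauss_term_0_sum:
  "(\<Sum>n<M. gauss_term 0 n)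
     = 1 - (- 1) ^ M * qpochhammer (q ^ 4) (q ^ 4) M * q ^ (2 * M) * (1 - q\<^sup>2) * r M * r (Suc M)"
proof (induction M)
  case 0
  have "(1 - q\<^sup>2) * r (Suc 0) = r 0"
    using r_Suc [of 0] by (simp only: mult_0_right add_0_left)
  then show ?case
    by (simp add: qpochhammer_def r_0)
next
  case (Suc M)
  define a b where "a = r (Suc M)" and "b = r (Suc (Suc M))"
  define v where "v = q ^ M"
  define c where "c = (- 1) ^ M * qpochhammer (q ^ 4) (q ^ 4) M * v\<^sup>2"
  have pow: "q ^ (2 * M) = v\<^sup>2" "q ^ (2 * M + 2) = v\<^sup>2 * q\<^sup>2"
      "q ^ (2 * Suc M) = v\<^sup>2 * q\<^sup>2"
    "q ^ (4 * M + 4) = v ^ 4 * q ^ 4" "q ^ (2 * Suc M + 2) = v\<^sup>2 * q ^ 4"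
    unfolding v_def power_mult [symmetric] power_add [symmetric]
    by (rule arg_cong [where f = "power q"]; simp)+
  have rM: "r M = (1 - v\<^sup>2 * q\<^sup>2) * a"
    using r_Suc [of M] unfolding pow a_def .
  have a: "a = (1 - v\<^sup>2 * q ^ 4) * b"
    using r_Suc [of "Suc M"] unfolding pow a_def b_def .
  have t: "gauss_term 0 M = c * (1 - q ^ 4) * ((1 - v\<^sup>2 * q\<^sup>2) * a) * b"
    unfolding gauss_term_def pow c_def by (simp add: rd_def rM b_def)
  have K: "(- 1) ^ M * qpochhammer (q ^ 4) (q ^ 4) M * q ^ (2 * M) * (1 - q\<^sup>2) * r M * r (Suc M)
      = c * (1 - q\<^sup>2) * ((1 - v\<^sup>2 * q\<^sup>2) * a) * ((1 - v\<^sup>2 * q ^ 4) * b)"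
    unfolding pow c_def rM a [symmetric] by (simp only: a_def)
  have K': "(- 1) ^ Suc M * qpochhammer (q ^ 4) (q ^ 4) (Suc M) * q ^ (2 * Suc M) * (1 - q\<^sup>2) * r (Suc M)
      * r (Suc (Suc M))
      = - (c * (1 - v ^ 4 * q ^ 4) * q\<^sup>2 * (1 - q\<^sup>2) * a * b)"
    unfolding pochhammer4_Suc pow c_def a_def b_def by (simp add: mult_ac)
  show ?case
    unfolding sum.lessThan_Suc Suc.IH t K K' by (simp add: algebra_simps eval_nat_numeral)
qed

text \<open>A contiguous relation: this combination telescopes in n. Up to multiples of q^(2M),
  passing from k to k+1 thus multiplies the sum by -q^2.\<close>

lemma gauss_term_Suc_sum:
  "(\<Sum>n<M. gauss_term (Suc k) n) + q\<^sup>2 * (\<Sum>n<M. gauss_term k n)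
     = - ((- 1) ^ M * qpochhammer (q ^ 4) (q ^ 4) M * q ^ (2 * M) * (1 - q ^ (4 * k + 6))
         * rd M (Suc k) * r (M + k + 2))"
proof (induction M)
  case 0
  then show ?case by simp
next
  case (Suc M)
  show ?case
  proof (cases "k \<le> M")
    \<comment> \<open>All new terms vanish here, since \<open>rd M k\<close> and
      \<open>rd (Suc M) (Suc k)\<close> are 0.\<close>
    case False
    then show ?thesis
      using Suc.IH by (simp add: gauss_term_def)
  next
    case True
    then obtain m where M: "M = k + m"
      using le_Suc_ex by blast
    define a b where "a = rd M k" and "b = r (M + k + 3)"
    define u v where "u = q ^ k" and "v = q ^ m"
    define c where "c = (- 1) ^ M * qpochhammer (q ^ 4) (q ^ 4) M * (u\<^sup>2 * v\<^sup>2)"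
    have pow: "q ^ (2 * m) = v\<^sup>2" "q ^ (2 * M) = u\<^sup>2 * v\<^sup>2"
        "q ^ (2 * Suc M) = u\<^sup>2 * v\<^sup>2 * q\<^sup>2"
      "q ^ (4 * M + 4) = u ^ 4 * v ^ 4 * q ^ 4" "q ^ (2 * (M + k + 2) + 2) = u ^ 4 * v\<^sup>2 * q ^ 6"
      "q ^ (4 * k + 4) = u ^ 4 * q ^ 4" "q ^ (4 * k + 6) = u ^ 4 * q ^ 6" "q ^ (4 * Suc k + 4) = u ^ 4 * q ^ 8"
      unfolding u_def v_def M power_mult [symmetric] power_add [symmetric]
      by (rule arg_cong [where f = "power q"]; simp)+
    have rd: "rd M (Suc k) = (1 - v\<^sup>2) * a"
      using rd_Suc_right [OF True] unfolding a_def M diff_add_inverse pow .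
    have rd': "rd (Suc M) (Suc k) = a"
      by (simp add: a_def rd_def)
    have idx: "M + Suc k + 2 = M + k + 3" "Suc M + k + 2 = M + k + 3" "Suc (M + k + 2) = M + k + 3"
      by simp_all
    have r: "r (M + k + 2) = (1 - u ^ 4 * v\<^sup>2 * q ^ 6) * b"
      using r_Suc [of "M + k + 2"] unfolding pow idx b_def .
    have terms: "gauss_term (Suc k) M = c * (1 - u ^ 4 * q ^ 8) * ((1 - v\<^sup>2) * a) * b"
      "gauss_term k M = c * (1 - u ^ 4 * q ^ 4) * a * ((1 - u ^ 4 * v\<^sup>2 * q ^ 6) * b)"
      unfolding gauss_term_def c_def pow idx rd r a_def b_def by (rule refl)+
    have K: "(- 1) ^ M * qpochhammer (q ^ 4) (q ^ 4) M * q ^ (2 * M) * (1 - q ^ (4 * k + 6))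
        * rd M (Suc k) * r (M + k + 2)
      = c * (1 - u ^ 4 * q ^ 6) * ((1 - v\<^sup>2) * a) * ((1 - u ^ 4 * v\<^sup>2 * q ^ 6) * b)"
      unfolding c_def pow rd r by (rule refl)
    have K': "(- 1) ^ Suc M * qpochhammer (q ^ 4) (q ^ 4) (Suc M) * q ^ (2 * Suc M) * (1 - q ^ (4 * k + 6))
        * rd (Suc M) (Suc k) * r (Suc M + k + 2)
      = - (c * (1 - u ^ 4 * v ^ 4 * q ^ 4) * q\<^sup>2 * (1 - u ^ 4 * q ^ 6) * a * b)"
      unfolding c_def pochhammer4_Suc pow rd' idx b_def by (simp add: mult_ac)
    have "(\<Sum>n<Suc M. gauss_term (Suc k) n) + q\<^sup>2 * (\<Sum>n<Suc M. gauss_term k n)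
      = ((\<Sum>n<M. gauss_term (Suc k) n) + q\<^sup>2 * (\<Sum>n<M. gauss_term k n))
          + (gauss_term (Suc k) M + q\<^sup>2 * gauss_term k M)"
      by (simp add: distrib_left)
    then show ?thesis
      unfolding Suc.IH K K' terms by (simp add: algebra_simps eval_nat_numeral)
  qed
qed

text \<open>
  A truncated instance of the \<open>q\<close>-Gauss sum, namely
  \<open>\<^sub>2\<phi>\<^sub>1(q\<^bsup>2k+2\<^esup>, - q\<^bsup>2k+2\<^esup>; q\<^bsup>4k+6\<^esup>; q\<^sup>2, - q\<^sup>2)\<close>.  Modulo a power of \<^term>\<open>q\<close> no limit is
  needed, so the argument stays in an arbitrary commutative ring.
\<close>
lemma gauss_sum_cong:
  "q ^ (2 * M) dvd (\<Sum>n<M. gauss_term k n) - (- 1) ^ k * q ^ (2 * k)"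
proof (induction k)
  case 0
  show ?case
    unfolding gauss_term_0_sum by simp
next
  case (Suc k)
  have "(\<Sum>n<M. gauss_term (Suc k) n) - (- 1) ^ Suc k * q ^ (2 * Suc k)
    = ((\<Sum>n<M. gauss_term (Suc k) n) + q\<^sup>2 * (\<Sum>n<M. gauss_term k n))
      - q\<^sup>2 * ((\<Sum>n<M. gauss_term k n) - (- 1) ^ k * q ^ (2 * k))"
    by (simp add: algebra_simps power2_eq_square)
  moreover have "q ^ (2 * M) dvd (\<Sum>n<M. gauss_term (Suc k) n) + q\<^sup>2 * (\<Sum>n<M. gauss_term k n)"
    unfolding gauss_term_Suc_sum by simp
  ultimately show ?case
    using Suc.IH by (simp only: dvd_diff dvd_mult)
qed

section \<open>The Hecke-type double sum\<close>

text \<open>Expand \<open>s n\<close> by \<open>bailey_pair\<close>, exchange the two finite sums,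
  and evaluate the inner one by \<open>gauss_sum_cong\<close>.\<close>

lemma hecke_sum_cong:
  assumes s: "\<And>n. (1 - q ^ (2 * n + 1)) * s n = 1"
  shows "q ^ (2 * M) dvd (\<Sum>n<M. (- 1) ^ n * qpochhammer (- (q\<^sup>2)) (q\<^sup>2) n * s n * q ^ (2 * n))
           - (\<Sum>k<M. q ^ (k\<^sup>2 + 2 * k) * tri_sum (2 * Suc k))"
proof -
  define f where "f = (\<lambda>n k. (- 1) ^ k * q ^ k\<^sup>2 * (1 - q ^ (4 * k + 4))
      * rd n k * r (n + k + 2) * tri_sum (2 * Suc k))"
  have poch: "qpochhammer (- (q\<^sup>2)) (q\<^sup>2) n * qpochhammer (q\<^sup>2) (q\<^sup>2) n = qpochhammer (q ^ 4) (q ^ 4) n" for n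
    unfolding qpochhammer_def prod.distrib [symmetric]
  proof (rule prod.cong [OF refl])
    fix j
    define x where "x = q\<^sup>2 * (q\<^sup>2) ^ j"
    have x2: "q ^ 4 * (q ^ 4) ^ j = x * x"
      unfolding x_def power_mult [symmetric] power_add [symmetric]
      by (rule arg_cong [where f = "power q"]) simp
    show "(1 - - (q\<^sup>2) * (q\<^sup>2) ^ j) * (1 - q\<^sup>2 * (q\<^sup>2) ^ j) = 1 - q ^ 4 * (q ^ 4) ^ j"
      unfolding x2 mult_minus_left x_def [symmetric] by (simp add: algebra_simps)
  qed
  have summand: "(- 1) ^ n * qpochhammer (- (q\<^sup>2)) (q\<^sup>2) n * s n * q ^ (2 * n)
      = (\<Sum>k<M. (- 1) ^ k * q ^ k\<^sup>2 * tri_sum (2 * Suc k) * gauss_term k n)" if "n < M" for n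
  proof -
    have "s n = s n * (qpochhammer (q\<^sup>2) (q\<^sup>2) n * r n)"
      by (simp add: pochhammer_r)
    also have "r n = (1 - q ^ (2 * n + 1)) * (\<Sum>k\<le>n. f n k)"
      unfolding f_def by (rule bailey_pair [symmetric])
    also have "s n * (qpochhammer (q\<^sup>2) (q\<^sup>2) n * ((1 - q ^ (2 * n + 1)) * (\<Sum>k\<le>n. f n k)))
        = ((1 - q ^ (2 * n + 1)) * s n) * (qpochhammer (q\<^sup>2) (q\<^sup>2) n * (\<Sum>k\<le>n. f n k))"
      by (simp only: mult_ac)
    \<comment> \<open>A range independent of n makes the later exchange of sums immediate; the added
      terms contain \<open>rd n k\<close> with k > n.\<close>
    also have "(\<Sum>k\<le>n. f n k) = (\<Sum>k<M. f n k)"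
      using that by (intro sum.mono_neutral_left) (auto simp: f_def)
    finally have "s n = qpochhammer (q\<^sup>2) (q\<^sup>2) n * (\<Sum>k<M. f n k)"
      unfolding s by simp
    then have "(- 1) ^ n * qpochhammer (- (q\<^sup>2)) (q\<^sup>2) n * s n * q ^ (2 * n)
      = (- 1) ^ n * (qpochhammer (- (q\<^sup>2)) (q\<^sup>2) n * qpochhammer (q\<^sup>2) (q\<^sup>2) n)
          * q ^ (2 * n) * (\<Sum>k<M. f n k)"
      by (simp only: mult_ac)
    also have "\<dots> = (\<Sum>k<M. (- 1) ^ k * q ^ k\<^sup>2 * tri_sum (2 * Suc k) * gauss_term k n)"
      unfolding poch sum_distrib_left f_def gauss_term_def
      by (intro sum.cong refl) (simp only: mult_ac)
    finally show ?thesis .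
  qed
  have "(\<Sum>n<M. (- 1) ^ n * qpochhammer (- (q\<^sup>2)) (q\<^sup>2) n * s n * q ^ (2 * n))
    = (\<Sum>n<M. \<Sum>k<M. (- 1) ^ k * q ^ k\<^sup>2 * tri_sum (2 * Suc k) * gauss_term k n)"
    by (intro sum.cong refl summand) simp
  also have "\<dots> = (\<Sum>k<M. (- 1) ^ k * q ^ k\<^sup>2 * tri_sum (2 * Suc k) * (\<Sum>n<M. gauss_term k n))"
    by (subst sum.swap) (simp only: sum_distrib_left)
  finally have lhs: "(\<Sum>n<M. (- 1) ^ n * qpochhammer (- (q\<^sup>2)) (q\<^sup>2) n * s n * q ^ (2 * n))
    = (\<Sum>k<M. (- 1) ^ k * q ^ k\<^sup>2 * tri_sum (2 * Suc k) * (\<Sum>n<M. gauss_term k n))" .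
  \<comment> \<open>The sign of the Bailey pair cancels the sign of the q-Gauss value.\<close>
  have "q ^ (k\<^sup>2 + 2 * k) * tri_sum (2 * Suc k)
      = (- 1) ^ k * q ^ k\<^sup>2 * tri_sum (2 * Suc k) * ((- 1) ^ k * q ^ (2 * k))" for k
  proof -
    have "(- 1) ^ k * (- 1) ^ k = (1 :: 'a)"
      by (simp flip: power_mult_distrib)
    then have "q ^ k\<^sup>2 * q ^ (2 * k) * tri_sum (2 * Suc k)
        = ((- 1) ^ k * (- 1) ^ k) * q ^ k\<^sup>2 * q ^ (2 * k) * tri_sum (2 * Suc k)"
      by (simp only: mult_1)
    then show ?thesis
      unfolding power_add by (simp only: mult_ac)
  qed
  then have "(\<Sum>n<M. (- 1) ^ n * qpochhammer (- (q\<^sup>2)) (q\<^sup>2) n * s n * q ^ (2 * n))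
           - (\<Sum>k<M. q ^ (k\<^sup>2 + 2 * k) * tri_sum (2 * Suc k))
    = (\<Sum>k<M. (- 1) ^ k * q ^ k\<^sup>2 * tri_sum (2 * Suc k)
        * ((\<Sum>n<M. gauss_term k n) - (- 1) ^ k * q ^ (2 * k)))"
    unfolding lhs by (simp only: sum_subtractf [symmetric] right_diff_distrib)
  then show ?thesis
    using gauss_sum_cong by (simp only: dvd_sum dvd_mult)
qed

end

section \<open>Integer power series and reduction modulo 2\<close>

lemma qpochhammer_nth_0:
  fixes a q :: "'a::comm_ring_1 fps"
  assumes "fps_nth a 0 = 0"
  shows "fps_nth (qpochhammer a q n) 0 = 1"
  unfolding qpochhammer_def by (induction n) (simp_all add: assms)

interpretation q_reciprocals "fps_X :: int fps"
  "\<lambda>n. fps_right_inverse (qpochhammer (fps_X\<^sup>2) (fps_X\<^sup>2) n) 1"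
proof
  show "qpochhammer (fps_X\<^sup>2) (fps_X\<^sup>2) n * fps_right_inverse (qpochhammer (fps_X\<^sup>2) (fps_X\<^sup>2) n) 1
    = (1 :: int fps)" for n
    by (rule fps_right_inverse) (simp add: qpochhammer_nth_0)
qed

lemma qpochhammer_double:
  "qpochhammer a q (2 * n) = qpochhammer a (q\<^sup>2) n * qpochhammer (a * q) (q\<^sup>2) n"
  by (induction n) (simp_all add: qpochhammer_def mult_ac flip: power_mult)

lemma qpochhammer_uminus_cong_2: "2 dvd qpochhammer (- a) q n - qpochhammer a q n"
proof (induction n)
  case (Suc n)
  then obtain d where d: "qpochhammer (- a) q n = qpochhammer a q n + 2 * d"
    by (metis dvdE diff_eq_eq add.commute)
  have "qpochhammer (- a) q (Suc n) - qpochhammer a q (Suc n)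
    = 2 * (qpochhammer a q n * (a * q ^ n) + d * (1 + a * q ^ n))"
    using d by (simp add: qpochhammer_def algebra_simps)
  then show ?case
    by simp
qed (simp add: qpochhammer_def)

lemma t_o_summand_cong_2:
  obtains s :: "nat \<Rightarrow> int fps"
  where "\<And>n. (1 - fps_X ^ (2 * n + 1)) * s n = 1"
    and "\<And>n. 2 dvd t_o_summand n
               - (- 1) ^ n * qpochhammer (- (fps_X\<^sup>2)) (fps_X\<^sup>2) n * s n * fps_X ^ (2 * n)"
proof
  let ?X = "fps_X :: int fps"
  let ?A = "qpochhammer ?X (?X\<^sup>2)" and ?B = "qpochhammer (- ?X) (?X\<^sup>2)"
      and ?E = "qpochhammer (- (?X\<^sup>2)) (?X\<^sup>2)"
  define t where "t n = fps_right_inverse (?A (n + 1)) 1" for n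
  \<comment> \<open>Since \<open>t n\<close> inverts \<open>?A (n + 1)\<close>, this is 1/(1 -
    q^(2n+1)).\<close>
  define s where "s n = ?A n * t n" for n
  show "(1 - ?X ^ (2 * n + 1)) * s n = 1" for n
  proof -
    have "?A (n + 1) = ?A n * (1 - ?X ^ (2 * n + 1))"
      by (simp add: qpochhammer_def power_mult)
    then show ?thesis
      using qpochhammer_odd_inverse [of "n + 1"] by (simp add: s_def t_def mult_ac)
  qed
  show "2 dvd t_o_summand n - (- 1) ^ n * ?E n * s n * ?X ^ (2 * n)" for n
  proof -
    obtain d where "?B n - ?A n = 2 * d"
      using qpochhammer_uminus_cong_2 by (rule dvdE)
    then have d: "?B n = ?A n + 2 * d"
      by (simp add: algebra_simps)
    \<comment> \<open>The sign is 1 modulo 2; inserting it produces the argument -q^2 of the q-Gauss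
      sum.\<close>
    have "2 dvd (1 - (- 1) ^ n :: int fps)"
      by (cases "even n") simp_all
    then obtain e where "1 - (- 1) ^ n = (2 * e :: int fps)"
      by (rule dvdE)
    then have e: "(- 1) ^ n = (1 - 2 * e :: int fps)"
      by (simp add: algebra_simps)
    have "t_o_summand n = ?B n * ?E n * t n * ?X ^ (2 * n)"
      unfolding t_o_summand_def t_def qpochhammer_double by (simp add: power2_eq_square)
    then have "t_o_summand n - (- 1) ^ n * ?E n * s n * ?X ^ (2 * n)
      = 2 * (d * ?E n * t n * ?X ^ (2 * n) + e * ?E n * s n * ?X ^ (2 * n))"
      unfolding d e s_def by (simp add: algebra_simps)
    then show ?thesis
      by simp
  qed
qed

text \<open>Summand n starts at degree 2n or later, so summands beyond index k do not reach degree
  k.\<close>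

lemma t_o_eq: "t_o k = fps_nth (\<Sum>n<Suc k. t_o_summand n) k"
proof -
  have "(\<lambda>N. \<Sum>n<N. t_o_summand n) \<longlonglongrightarrow> Abs_fps t_o"
    using t_o_summand_sums by (simp add: sums_def)
  then have "\<forall>\<^sub>F N in sequentially. fps_nth (\<Sum>n<N. t_o_summand n) k = t_o k"
    by (simp add: tendsto_fps_iff)
  then obtain N where "N \<ge> Suc k" and N: "fps_nth (\<Sum>n<N. t_o_summand n) k = t_o k"
    unfolding eventually_sequentially by (meson nat_le_linear)
  then have "(\<Sum>n<Suc k. fps_nth (t_o_summand n) k) = (\<Sum>n<N. fps_nth (t_o_summand n) k)"
    by (intro sum.mono_neutral_left) (auto intro!: t_o_summand_nth_eq_0)
  then show ?thesis
    using N by (simp add: fps_sum_nth)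
qed

section \<open>The quadratic form and the conclusion\<close>

text \<open>Complete both squares, splitting 9 = 1 + 8: 4j(j+1) + 1 = (2j+1)^2 and 8(k^2+2k) + 8 =
  2(2k+2)^2.\<close>

lemma triangular_represented:
  fixes j k :: nat
  shows "8 * int (k\<^sup>2 + 2 * k + j * (j + 1) div 2) + 9
      = (int (2 * j + 1))\<^sup>2 + 2 * (int (2 * k + 2))\<^sup>2"
proof -
  have "2 * (j * (j + 1) div 2) = j * (j + 1)"
    by simp
  then have "2 * int (j * (j + 1) div 2) = int j * (int j + 1)"
    by (metis of_nat_mult of_nat_add of_nat_1 of_nat_numeral)
  then show ?thesis
    by (simp only: of_nat_add of_nat_mult of_nat_power) (simp add: power2_eq_square algebra_simps)
qed

theorem theorem1p3:
  fixes n :: nat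
  assumes "\<not> (\<exists>x y :: int. 8 * int n + 9 = x\<^sup>2 + 2 * y\<^sup>2)"
  shows "[t_o n = 0] (mod 2)"
proof -
  obtain s :: "nat \<Rightarrow> int fps" where s: "\<And>n. (1 - fps_X ^ (2 * n + 1)) * s n = 1"
    and cong: "\<And>n. 2 dvd t_o_summand n
               - (- 1) ^ n * qpochhammer (- (fps_X\<^sup>2)) (fps_X\<^sup>2) n * s n * fps_X ^ (2 * n)"
    using t_o_summand_cong_2 by blast
  define S where "S = (\<Sum>m<Suc n. (- 1) ^ m * qpochhammer (- (fps_X\<^sup>2)) (fps_X\<^sup>2) m * s m * fps_X ^ (2 * m))"
  define H :: "int fps" where "H = (\<Sum>k<Suc n. fps_X ^ (k\<^sup>2 + 2 * k) * tri_sum (2 * Suc k))"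
  have "2 dvd (\<Sum>m<Suc n. t_o_summand m) - S"
    unfolding S_def sum_subtractf [symmetric] by (intro dvd_sum cong)
  then obtain d where d: "(\<Sum>m<Suc n. t_o_summand m) - S = 2 * d"
    by (rule dvdE)
  \<comment> \<open>Truncating at M = n+1 leaves an error of order q^(2n+2), beyond degree
    n.\<close>
  obtain e where e: "S - H = fps_X ^ (2 * Suc n) * e"
    using hecke_sum_cong [OF s] unfolding S_def H_def by (rule dvdE)
  \<comment> \<open>These are the exponents occurring in \<open>H\<close>, so its coefficient at n
    is exactly 0; only the passage to \<open>S\<close> is modulo 2.\<close>
  have "n \<noteq> k\<^sup>2 + 2 * k + j * (j + 1) div 2" for j k
    using assms triangular_represented by blast
  then have "fps_nth H n = 0"
    unfolding H_def tri_sum_def sum_distrib_left power_add [symmetric] fps_sum_nth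
    by (intro sum.neutral ballI) simp
  moreover have "fps_nth (S - H) n = 0"
    unfolding e fps_X_power_mult_nth by simp
  moreover have "fps_nth ((\<Sum>m<Suc n. t_o_summand m) - S) n = 2 * fps_nth d n"
    unfolding d by (simp add: fps_numeral_fps_const)
  ultimately have "t_o n = 2 * fps_nth d n"
    by (simp add: t_o_eq)
  then show ?thesis
    by (simp add: cong_0_iff)
qed

end
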